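(* Let $X$ be a $T_0$ space such that $\mathord{\downarrow}(A\cap W)$ is closed in $X$ for every irreducible closed subset $A\in\mathbf{IRR}(X)$ and every upper set $W\subseteq X$. Then the $D$-completion of $X$ coincides with the sobrification of $X$.
   Context: For a $T_0$ space $X$, the specialization order is $x\le y$ iff $x\in cl(\{y\})$; $\mathord{\downarrow}$ and upper sets refer to it. $\Gamma(X)$ is the set of closed subsets of $X$. The lower Vietoris topology on a family of closed sets has as subbasis the sets $\diamondsuit U=\{A: A\cap U\neq\emptyset\}$, $U$ open in $X$. The sobrification of $X$ is the set $\mathbf{IRR}(X)$ of (nonempty) irreducible closed subsets with the lower Vietoris topology, with embedding $x\mapsto\mathord{\downarrow}x=cl(\{x\})$. A monotone convergence space is a $T_0$ space in which the closure of every directed set (in the specialization order) is the closure of a unique point. A subset of a poset is $d$-closed if it contains the supremum (when it exists) of each of its directed subsets; $cl_d(B)$ is the smallest $d$-closed set containing $B$. A $D$-completion of $X$ is a monotone convergence space $Y$ with a topological embedding $j:X\to Y$ such that $cl_d(j(X))=Y$. It is unique up to homeomorphism; its standard form is the $d$-closure of $\{\mathord{\downarrow}x:x\in X\}$ in $(\Gamma(X),\subseteq)$ with the lower Vietoris topology, and it is contained in $\mathbf{IRR}(X)$. "Coincides" means that this subset of $\Gamma(X)$ equals $\mathbf{IRR}(X)$. *)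

theory Defs
  imports "HOL-Analysis.Analysis" "HOL-Library.Lub_Glb"
begin

text \<open>\<open>spec_le X x y\<close> forces both points into \<^term>\<open>topspace X\<close>, since
  \<^term>\<open>X closure_of {y}\<close> is empty for \<open>y\<close> outside \<^term>\<open>topspace X\<close>.\<close>

definition spec_le :: "'a topology \<Rightarrow> 'a \<Rightarrow> 'a \<Rightarrow> bool" where
  "spec_le X x y \<longleftrightarrow> x \<in> X closure_of {y}"

definition down_set :: "'a topology \<Rightarrow> 'a set \<Rightarrow> 'a set" where
  "down_set X A = {x. \<exists>a\<in>A. spec_le X x a}"

definition upper_set :: "'a topology \<Rightarrow> 'a set \<Rightarrow> bool" where
  "upper_set X W \<longleftrightarrow> W \<subseteq> topspace X \<and> (\<forall>x\<in>W. \<forall>y. spec_le X x y \<longrightarrow> y \<in> W)"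

definition closed_sets :: "'a topology \<Rightarrow> 'a set set" where
  "closed_sets X = {A. closedin X A}"

definition IRR :: "'a topology \<Rightarrow> 'a set set" where
  "IRR X = {A. closedin X A \<and> A \<noteq> {} \<and>
     (\<forall>B C. closedin X B \<and> closedin X C \<and> A \<subseteq> B \<union> C \<longrightarrow> A \<subseteq> B \<or> A \<subseteq> C)}"

text \<open>\<^const>\<open>topology_generated_by\<close> takes the union of the generators as carrier, so the
  carrier \<open>F\<close> (the empty intersection of subbasic sets) is added as a generator.\<close>

definition lower_vietoris :: "'a topology \<Rightarrow> 'a set set \<Rightarrow> 'a set topology" where
  "lower_vietoris X F =
     topology_generated_by (insert F {{A \<in> F. A \<inter> U \<noteq> {}} | U. openin X U})"

lemma topspace_lower_vietoris [simp]: "topspace (lower_vietoris X F) = F"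
  unfolding lower_vietoris_def topology_generated_by_topspace by blast

definition directed :: "'b::order set \<Rightarrow> bool" where
  "directed D \<longleftrightarrow> D \<noteq> {} \<and> (\<forall>x\<in>D. \<forall>y\<in>D. \<exists>z\<in>D. x \<le> z \<and> y \<le> z)"

text \<open>\<^term>\<open>isLub P D s\<close> says that \<open>s\<close> is the supremum of \<open>D\<close> relative to the poset \<open>P\<close>,
  not to the whole type.\<close>

definition d_closed :: "'b::order set \<Rightarrow> 'b set \<Rightarrow> bool" where
  "d_closed P C \<longleftrightarrow> C \<subseteq> P \<and> (\<forall>D s. D \<subseteq> C \<and> directed D \<and> isLub P D s \<longrightarrow> s \<in> C)"

definition d_closure :: "'b::order set \<Rightarrow> 'b set \<Rightarrow> 'b set" where
  "d_closure P B = \<Inter>{C. d_closed P C \<and> B \<subseteq> C}"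

definition sobrification :: "'a topology \<Rightarrow> 'a set topology" where
  "sobrification X = lower_vietoris X (IRR X)"

text \<open>A D-completion is unique only up to homeomorphism; this is its standard form, built inside
  the poset of closed sets under inclusion.\<close>

definition D_completion :: "'a topology \<Rightarrow> 'a set topology" where
  "D_completion X = lower_vietoris X
     (d_closure (closed_sets X) ((\<lambda>x. X closure_of {x}) ` topspace X))"

lemma D_completion_eq_sobrification_iff:
  "D_completion X = sobrification X \<longleftrightarrow>
     d_closure (closed_sets X) ((\<lambda>x. X closure_of {x}) ` topspace X) = IRR X"
  unfolding D_completion_def sobrification_def by (metis topspace_lower_vietoris)

end

theory Submission
  imports Defs
begin

text \<open>The hypothesis forces every irreducible closed set \<open>A\<close> to be directed in the specialization
  order. Fix \<open>x \<in> A\<close>. Each point of \<open>A\<close> either has a common upper bound with \<open>x\<close> inside \<open>A\<close>, and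
  then lies below \<open>A \<inter> \<up>x\<close>, or it belongs to the set \<open>B\<close> of points of \<open>A\<close> that have no
  such bound. Both \<open>A \<inter> \<up>x\<close> and \<open>B\<close> are traces on \<open>A\<close> of upper sets, so \<open>A\<close> is covered
  by the two closed sets \<open>\<down>(A \<inter> \<up>x)\<close> and \<open>\<down>B\<close>. The second does not contain \<open>x\<close>, so
  irreducibility gives \<open>A = \<down>(A \<inter> \<up>x)\<close>: every point of \<open>A\<close> is bounded together with \<open>x\<close>
  (lemma \<open>IRR_spec_directed\<close>).

  A directed closed set \<open>A\<close> is the supremum, in the poset of closed sets, of the directed family of
  the point closures \<open>cl {x}\<close> with \<open>x \<in> A\<close>, so it is reached from point closures by a single
  directed supremum (lemma \<open>directed_closedin_in_d_closure\<close>). Conversely, the irreducible closed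
  sets contain the point closures and are closed under directed suprema of closed sets (lemma
  \<open>IRR_d_closed\<close>), so the d-closure of the point closures contains nothing else.\<close>

lemma spec_le_refl: "x \<in> topspace X \<Longrightarrow> spec_le X x x"
  unfolding spec_le_def by (simp add: in_closure_of)

lemma spec_le_iff_closure_subset:
  assumes "x \<in> topspace X"
  shows "spec_le X x y \<longleftrightarrow> X closure_of {x} \<subseteq> X closure_of {y}"
proof
  assume "spec_le X x y"
  then show "X closure_of {x} \<subseteq> X closure_of {y}"
    unfolding spec_le_def by (simp add: closure_of_minimal)
next
  assume "X closure_of {x} \<subseteq> X closure_of {y}"
  with spec_le_refl[OF assms] show "spec_le X x y"
    unfolding spec_le_def by blast
qed

lemma spec_le_in_topspace:
  assumes "spec_le X x y"
  shows "x \<in> topspace X" and "y \<in> topspace X"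
proof -
  show "x \<in> topspace X"
    using assms unfolding spec_le_def by (simp add: in_closure_of)
  show "y \<in> topspace X"
    using assms unfolding spec_le_def by (auto simp: in_closure_of)
qed

lemma spec_le_trans:
  assumes "spec_le X x y" "spec_le X y z"
  shows "spec_le X x z"
proof -
  have "X closure_of {y} \<subseteq> X closure_of {z}"
    using assms(2) spec_le_iff_closure_subset[OF spec_le_in_topspace(1)[OF assms(2)]] by blast
  then show ?thesis
    using assms(1) unfolding spec_le_def by (rule subsetD)
qed

lemma IRR_spec_directed:
  assumes closed: "\<And>W. upper_set X W \<Longrightarrow> closedin X (down_set X (A \<inter> W))"
    and A: "A \<in> IRR X" and x: "x \<in> A" and y: "y \<in> A"
  obtains z where "z \<in> A" "spec_le X x z" "spec_le X y z"
proof -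
  have AX: "A \<subseteq> topspace X"
    using A unfolding IRR_def by (simp add: closedin_subset)
  define U where "U = {w. spec_le X x w}"
  define B where "B = {a \<in> A. \<not> (\<exists>z\<in>A. spec_le X x z \<and> spec_le X a z)}"
  define V where "V = {w. \<exists>b\<in>B. spec_le X b w}"
  have "upper_set X U"
    unfolding upper_set_def U_def using spec_le_in_topspace(2)[of X] spec_le_trans[of X] by auto
  moreover have "upper_set X V"
    unfolding upper_set_def V_def using spec_le_in_topspace(2)[of X] spec_le_trans[of X] by fast
  ultimately have cl: "closedin X (down_set X (A \<inter> U))" "closedin X (down_set X (A \<inter> V))"
    by (simp_all add: closed)
  have "A \<subseteq> down_set X (A \<inter> U) \<union> down_set X (A \<inter> V)"
  proof
    fix a assume a: "a \<in> A"
    show "a \<in> down_set X (A \<inter> U) \<union> down_set X (A \<inter> V)"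
    proof (cases "a \<in> B")
      case True
      then show ?thesis
        using a AX spec_le_refl[of a X] unfolding down_set_def V_def by blast
    next
      case False
      then show ?thesis
        using a unfolding down_set_def U_def B_def by blast
    qed
  qed
  with A cl have "A \<subseteq> down_set X (A \<inter> U) \<or> A \<subseteq> down_set X (A \<inter> V)"
    unfolding IRR_def by blast
  \<comment> \<open>A point of \<open>A \<inter> V\<close> above \<open>x\<close> would be a common bound of \<open>x\<close> and an element of \<open>B\<close>.\<close>
  moreover have "x \<notin> down_set X (A \<inter> V)"
    unfolding down_set_def V_def B_def by blast
  ultimately have "y \<in> down_set X (A \<inter> U)"
    using x y by blast
  then show thesis
    using that unfolding down_set_def U_def by blast
qed

lemma directed_closedin_in_d_closure:
  assumes A: "closedin X A" "A \<noteq> {}"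
    and dir: "\<And>x y. x \<in> A \<Longrightarrow> y \<in> A \<Longrightarrow> \<exists>z\<in>A. spec_le X x z \<and> spec_le X y z"
  shows "A \<in> d_closure (closed_sets X) ((\<lambda>x. X closure_of {x}) ` topspace X)"
proof -
  let ?D = "(\<lambda>x. X closure_of {x}) ` A"
  have AX: "A \<subseteq> topspace X"
    using A by (simp add: closedin_subset)
  have "directed ?D"
    unfolding directed_def
  proof (intro conjI ballI)
    fix P Q assume "P \<in> ?D" "Q \<in> ?D"
    then obtain x y where xy: "x \<in> A" "y \<in> A" "P = X closure_of {x}" "Q = X closure_of {y}"
      by blast
    then obtain z where "z \<in> A" "spec_le X x z" "spec_le X y z"
      using dir by blast
    with xy AX show "\<exists>R\<in>?D. P \<subseteq> R \<and> Q \<subseteq> R"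
      by (metis image_eqI spec_le_iff_closure_subset subsetD)
  qed (use A(2) in blast)
  moreover have "isLub (closed_sets X) ?D A"
  proof (rule isLubI2)
    show "isUb (closed_sets X) ?D A"
      using A(1) by (simp add: isUb_def setle_def closed_sets_def closure_of_minimal)
    show "A <=* Collect (isUb (closed_sets X) ?D)"
    proof (rule setgeI, rule ballI, rule subsetI)
      fix F x assume "F \<in> Collect (isUb (closed_sets X) ?D)" and x: "x \<in> A"
      then have "X closure_of {x} \<subseteq> F"
        by (auto simp: isUb_def setle_def)
      then show "x \<in> F"
        using spec_le_refl[of x X] x AX unfolding spec_le_def by blast
    qed
  qed
  ultimately have "A \<in> C"
    if "d_closed (closed_sets X) C" "(\<lambda>x. X closure_of {x}) ` topspace X \<subseteq> C" for C
    using that subset_trans[OF image_mono[OF AX] that(2)] unfolding d_closed_def by simp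
  then show ?thesis
    unfolding d_closure_def by simp
qed

lemma closure_of_singleton_in_IRR:
  assumes "x \<in> topspace X"
  shows "X closure_of {x} \<in> IRR X"
  unfolding IRR_def
proof (intro CollectI conjI allI impI)
  have x: "x \<in> X closure_of {x}"
    using spec_le_refl[OF assms] unfolding spec_le_def .
  then show "X closure_of {x} \<noteq> {}"
    by blast
  fix B C
  assume "closedin X B \<and> closedin X C \<and> X closure_of {x} \<subseteq> B \<union> C"
  with x show "X closure_of {x} \<subseteq> B \<or> X closure_of {x} \<subseteq> C"
    by (meson Un_iff closure_of_minimal empty_subsetI insert_subset subsetD)
qed simp

text \<open>If a directed supremum \<open>s\<close> were covered by closed sets \<open>B\<close> and \<open>C\<close>, neither of which
  bounds the family, then some member of the family would escape both at once. If \<open>B\<close>, say, bounds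
  the family, then it also contains the supremum, because \<open>B\<close> itself belongs to the poset.\<close>

lemma IRR_d_closed: "d_closed (closed_sets X) (IRR X)"
  unfolding d_closed_def
proof (intro conjI allI impI)
  show "IRR X \<subseteq> closed_sets X"
    unfolding IRR_def closed_sets_def by blast
  fix D s
  assume "D \<subseteq> IRR X \<and> directed D \<and> isLub (closed_sets X) D s"
  then have D: "D \<subseteq> IRR X" "directed D" and s: "isLub (closed_sets X) D s"
    by auto
  have closed: "closedin X s"
    using isLub_isUb[OF s] unfolding isUb_def closed_sets_def by blast
  have upper: "d \<subseteq> s" if "d \<in> D" for d
    using isLub_isUb[OF s] that unfolding isUb_def setle_def by blast
  have least: "s \<subseteq> B" if "closedin X B" "\<And>d. d \<in> D \<Longrightarrow> d \<subseteq> B" for B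
    using isLub_le_isUb[OF s, of B] that by (simp add: isUb_def setle_def closed_sets_def)
  have "D \<noteq> {}"
    using D(2) unfolding directed_def by simp
  then obtain d where d: "d \<in> D"
    by blast
  then have "d \<noteq> {}"
    using D(1) unfolding IRR_def by auto
  then have nonempty: "s \<noteq> {}"
    using upper[OF d] by blast
  have "s \<subseteq> B \<or> s \<subseteq> C" if B: "closedin X B" and C: "closedin X C" and cov: "s \<subseteq> B \<union> C" for B C
  proof (rule ccontr)
    assume "\<not> (s \<subseteq> B \<or> s \<subseteq> C)"
    then obtain d e where de: "d \<in> D" "\<not> d \<subseteq> B" "e \<in> D" "\<not> e \<subseteq> C"
      using least[OF B] least[OF C] by blast
    have "\<exists>f\<in>D. d \<subseteq> f \<and> e \<subseteq> f"
      using D(2) de(1,3) unfolding directed_def by simp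
    then obtain f where f: "f \<in> D" "d \<subseteq> f" "e \<subseteq> f"
      by blast
    have "f \<in> IRR X" "f \<subseteq> B \<union> C"
      using f(1) D(1) cov upper[OF f(1)] by auto
    then have "f \<subseteq> B \<or> f \<subseteq> C"
      using B C unfolding IRR_def by simp
    with de f show False
      by blast
  qed
  with closed nonempty show "s \<in> IRR X"
    unfolding IRR_def by blast
qed

theorem theorem3p13:
  fixes X :: "'a topology"
  assumes "t0_space X"
    and "\<And>A W. A \<in> IRR X \<Longrightarrow> upper_set X W \<Longrightarrow> closedin X (down_set X (A \<inter> W))"
  shows "D_completion X = sobrification X"
  unfolding D_completion_eq_sobrification_iff
proof
  show "d_closure (closed_sets X) ((\<lambda>x. X closure_of {x}) ` topspace X) \<subseteq> IRR X"
    unfolding d_closure_def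
    by (intro Inter_lower CollectI conjI IRR_d_closed image_subsetI closure_of_singleton_in_IRR)
  show "IRR X \<subseteq> d_closure (closed_sets X) ((\<lambda>x. X closure_of {x}) ` topspace X)"
  proof
    fix A assume A: "A \<in> IRR X"
    have "\<exists>z\<in>A. spec_le X x z \<and> spec_le X y z" if "x \<in> A" "y \<in> A" for x y
      using IRR_spec_directed[OF assms(2)[OF A] A that] by blast
    moreover have "closedin X A" "A \<noteq> {}"
      using A unfolding IRR_def by auto
    ultimately show "A \<in> d_closure (closed_sets X) ((\<lambda>x. X closure_of {x}) ` topspace X)"
      by (rule directed_closedin_in_d_closure[rotated 2])
  qed
qed

end
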